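(* Let $M\subseteq V$ and let $\{A,B,C\}$ be a partition of $M$. Then: (a) The table $\mathfrak{X}_{M}$ is strictly collapsible over $\mathfrak{X}_{A}$ into $\mathfrak{X}_{BC}$ with respect to $\lambda_{B'}^{ABC}$ and $\lambda_{B'C'}^{ABC}$ for all nonempty $B'\subseteq B$ and $C'\subseteq C$ if and only if $X_{A}\perp\!\!\!\perp X_{B}\mid X_{C}$. (b) The table $\mathfrak{X}_{M}$ is strictly collapsible over $\mathfrak{X}_{B}$ into $\mathfrak{X}_{AC}$ with respect to $\lambda_{A'}^{ABC}$ and $\lambda_{A'C'}^{ABC}$ for all nonempty $A'\subseteq A$ and $C'\subseteq C$ if and only if $X_{A}\perp\!\!\!\perp X_{B}\mid X_{C}$.
   Context: $V$ is a finite index set; for $v\in V$, $X_v$ is a categorical variable with finite level set $\mathfrak{X}_v=\{0,1,\dots,|\mathfrak{X}_v|-1\}$. For $A\subseteq V$, $X_A=(X_v)_{v\in A}$ and $\mathfrak{X}_A=\prod_{v\in A}\mathfrak{X}_v$ (with $|\mathfrak{X}_\emptyset|=1$); for $x\in\mathfrak{X}_A$ and $B\subseteq A$, $x_B$ is the restriction of $x$ to $B$. The joint distribution $p=p_V$ of $X_V$ on $\mathfrak{X}_V$ is strictly positive, and $p_A$ denotes its marginal on $\mathfrak{X}_A$. Juxtaposition denotes union: $ST=S\cup T$. The symbol $\subset$ denotes strict inclusion. For $L\subseteq M\subseteq V$ and $x_L\in\mathfrak{X}_L$, define $$\nu_L^M(x_L)=\frac{1}{|\mathfrak{X}_{M\setminus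 L}|}\sum_{j_M\in\mathfrak{X}_M:\,j_L=x_L}\log p_M(j_M),\qquad \lambda_L^M(x_L)=\sum_{L'\subseteq L}(-1)^{|L\setminus L'|}\nu_{L'}^M(x_{L'}).$$ $\lambda_L^M$ is called a marginal log-linear (MLL) parameter. For $\emptyset\ne L\subseteq K\subset M\subseteq V$, the table $\mathfrak{X}_M$ is strictly collapsible over $M\setminus K$ (also written: over $\mathfrak{X}_{M\setminus K}$) into $\mathfrak{X}_K$ with respect to $\lambda_L^M$ if (i) $\lambda_L^K(x_L)=\lambda_L^M(x_L)$ for all $x_L\in\mathfrak{X}_L$, and (ii) $\lambda_Z^M(x_Z)=0$ for all $x_Z\in\mathfrak{X}_Z$ and all $Z\subseteq M$ with $L\subset Z\not\subseteq K$. For a partition $\{A,B,C\}$ of $M$, $X_A\perp\!\!\!\perp X_B\mid X_C$ (conditional independence) means $p_M(x_M)\,p_C(x_C)=p_{AC}(x_{AC})\,p_{BC}(x_{BC})$ for all $x_M\in\mathfrak{X}_M$. *)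

theory Defs
  imports "HOL-Probability.Probability"
begin

text \<open>
  The level set of \<open>X\<^sub>v\<close> is \<open>{0, \<dots>, d v - 1}\<close>. The elements of \<open>table d A\<close> are extensional
  functions on \<open>A\<close>, so that \<open>x\<^sub>B\<close> is \<open>restrict x B\<close> and \<open>table d {}\<close> has exactly one element.
\<close>

definition table :: "('v \<Rightarrow> nat) \<Rightarrow> 'v set \<Rightarrow> ('v \<Rightarrow> nat) set" where
  "table d A = (\<Pi>\<^sub>E v\<in>A. {..<d v})"

definition marginal :: "('v \<Rightarrow> nat) pmf \<Rightarrow> 'v set \<Rightarrow> ('v \<Rightarrow> nat) pmf" where
  "marginal p A = map_pmf (\<lambda>x. restrict x A) p"

definition nu :: "('v \<Rightarrow> nat) \<Rightarrow> ('v \<Rightarrow> nat) pmf \<Rightarrow> 'v set \<Rightarrow> 'v set \<Rightarrow> ('v \<Rightarrow> nat) \<Rightarrow> real" where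
  "nu d p L M x =
     1 / real (card (table d (M - L))) *
     (\<Sum>j | j \<in> table d M \<and> restrict j L = x. ln (pmf (marginal p M) j))"

text \<open>In \<open>nu\<close> and \<open>mll\<close>, the first set is the subscript and the second one the superscript.\<close>

definition mll :: "('v \<Rightarrow> nat) \<Rightarrow> ('v \<Rightarrow> nat) pmf \<Rightarrow> 'v set \<Rightarrow> 'v set \<Rightarrow> ('v \<Rightarrow> nat) \<Rightarrow> real" where
  "mll d p L M x = (\<Sum>L' | L' \<subseteq> L. (- 1) ^ card (L - L') * nu d p L' M (restrict x L'))"

text \<open>
  \<open>strictly_collapsible d p M K L\<close>: the table over \<open>M\<close> is strictly collapsible over \<open>M - K\<close>
  into the table over \<open>K\<close> with respect to the parameter with subscript \<open>L\<close> and superscript \<open>M\<close>.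
\<close>

definition strictly_collapsible ::
    "('v \<Rightarrow> nat) \<Rightarrow> ('v \<Rightarrow> nat) pmf \<Rightarrow> 'v set \<Rightarrow> 'v set \<Rightarrow> 'v set \<Rightarrow> bool" where
  "strictly_collapsible d p M K L \<longleftrightarrow>
     L \<noteq> {} \<and> L \<subseteq> K \<and> K \<subset> M \<and>
     (\<forall>x\<in>table d L. mll d p L K x = mll d p L M x) \<and>
     (\<forall>Z. Z \<subseteq> M \<and> L \<subset> Z \<and> \<not> Z \<subseteq> K \<longrightarrow> (\<forall>x\<in>table d Z. mll d p Z M x = 0))"

definition cond_indep ::
    "('v \<Rightarrow> nat) \<Rightarrow> ('v \<Rightarrow> nat) pmf \<Rightarrow> 'v set \<Rightarrow> 'v set \<Rightarrow> 'v set \<Rightarrow> bool" where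
  "cond_indep d p A B C \<longleftrightarrow>
     (\<forall>x\<in>table d (A \<union> B \<union> C).
        pmf (marginal p (A \<union> B \<union> C)) x * pmf (marginal p C) (restrict x C) =
        pmf (marginal p (A \<union> C)) (restrict x (A \<union> C)) *
        pmf (marginal p (B \<union> C)) (restrict x (B \<union> C)))"

end

theory Submission
  imports Defs
begin

text \<open>
  The parameter \<open>mll d p Z M\<close> is the \<open>Z\<close>-interaction in the ANOVA decomposition of the function
  \<open>ln p\<^sub>M\<close> on the table over \<open>M\<close>, with respect to the uniform averages over the remaining
  coordinates. It is therefore studied as a linear operator \<open>interaction\<close> on arbitrary real
  functions on a table. Two facts about this operator carry the proof.

  The first is locality: if a function on the table over \<open>M\<close> depends on the coordinates in
  \<open>K\<close> only, then averaging over the coordinates outside \<open>K\<close> does nothing. Hence its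
  interactions with subscript not contained in \<open>K\<close> vanish (\<open>interaction_of_local_eq_0\<close>), and
  the others are the same whether computed over \<open>M\<close> or over \<open>K\<close>
  (\<open>interaction_of_local_eq\<close>). The second is Moebius inversion on the lattice of subsets: a
  function is the sum of its interactions (\<open>sum_interactions\<close>).

  Conditional independence says that
  \<open>ln p\<^sub>M = ln p\<^sub>A\<^sub>C + ln p\<^sub>B\<^sub>C - ln p\<^sub>C\<close>. Let \<open>Z \<subseteq> M\<close> meet \<open>B\<close>. By locality neither
  \<open>ln p\<^sub>A\<^sub>C\<close> nor \<open>ln p\<^sub>C\<close> contributes to the \<open>Z\<close>-interaction; \<open>ln p\<^sub>B\<^sub>C\<close> contributes
  nothing either if \<open>Z\<close> also meets \<open>A\<close>, and exactly the \<open>Z\<close>-parameter of the table over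
  \<open>B \<union> C\<close> if it does not. These are the two conditions of strict collapsibility.

  Conversely, each \<open>Z\<close> that meets both \<open>A\<close> and \<open>B\<close> strictly contains \<open>B' = Z \<inter> B\<close> and is not
  contained in \<open>B \<union> C\<close>, so collapsibility with respect to \<open>B'\<close> makes the \<open>Z\<close>-parameter vanish.
  By inversion, \<open>ln p\<^sub>M\<close> is then a sum of a function of \<open>x\<^sub>A\<^sub>C\<close> and a function of \<open>x\<^sub>B\<^sub>C\<close>, that
  is, \<open>p\<^sub>M\<close> factorizes, which implies conditional independence. The second equivalence is
  the first one with \<open>A\<close> and \<open>B\<close> exchanged.
\<close>

section \<open>Fibres of restriction maps between tables\<close>

definition fiber :: "('v \<Rightarrow> nat) \<Rightarrow> 'v set \<Rightarrow> 'v set \<Rightarrow> ('v \<Rightarrow> nat) \<Rightarrow> ('v \<Rightarrow> nat) set" where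
  "fiber d M L x = {j \<in> table d M. restrict j L = x}"

lemma finite_table: "finite A \<Longrightarrow> finite (table d A)"
  unfolding table_def by (intro finite_PiE) auto

lemma finite_fiber: "finite M \<Longrightarrow> finite (fiber d M L x)"
  unfolding fiber_def by (simp add: finite_table)

lemma restrict_in_table: "j \<in> table d M \<Longrightarrow> S \<subseteq> M \<Longrightarrow> restrict j S \<in> table d S"
  unfolding table_def by (auto simp: PiE_iff)

lemma restrict_table_id: "j \<in> table d M \<Longrightarrow> restrict j M = j"
  unfolding table_def by (auto simp: PiE_iff extensional_restrict)

lemma restrict_restrict_subset: "A \<subseteq> B \<Longrightarrow> restrict (restrict j B) A = restrict j A"
  by (simp add: Int_absorb1)

lemma table_nonempty_subset: "table d M \<noteq> {} \<Longrightarrow> S \<subseteq> M \<Longrightarrow> table d S \<noteq> {}"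
  using restrict_in_table by blast

lemma card_table: "finite A \<Longrightarrow> card (table d A) = (\<Prod>v\<in>A. d v)"
  unfolding table_def by (simp add: card_PiE)

lemma card_table_disjoint_Un:
  "finite A \<Longrightarrow> finite B \<Longrightarrow> A \<inter> B = {} \<Longrightarrow>
    card (table d (A \<union> B)) = card (table d A) * card (table d B)"
  by (simp add: card_table prod.union_disjoint)

lemma card_table_pos: "finite M \<Longrightarrow> table d M \<noteq> {} \<Longrightarrow> card (table d M) > 0"
  by (simp add: card_gt_0_iff finite_table)

text \<open>
  A point of the table over \<open>S \<union> T\<close> is the same as a pair of points of the two smaller tables that
  agree on \<open>S \<inter> T\<close>; once the first one is fixed, only the second one remains to be chosen.
\<close>
lemma bij_betw_restrict_fiber:
  assumes "S \<union> T = M" and s: "s \<in> table d S"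
  shows "bij_betw (\<lambda>j. restrict j T) (fiber d M S s) (fiber d T (S \<inter> T) (restrict s (S \<inter> T)))"
proof (rule bij_betw_byWitness[where f' = "\<lambda>t. merge S T (s, t)"])
  show "\<forall>j\<in>fiber d M S s. merge S T (s, restrict j T) = j"
  proof
    fix j assume j: "j \<in> fiber d M S s"
    have "merge S T (s, restrict j T) v = j v" for v
    proof (cases "v \<in> M")
      case True
      then show ?thesis using j assms(1) by (auto simp: merge_def fiber_def)
    next
      case False
      then show ?thesis using j assms(1)
        by (auto simp: merge_def fiber_def table_def PiE_iff extensional_def)
    qed
    then show "merge S T (s, restrict j T) = j" by blast
  qed
next
  have agree: "restrict (merge S T (s, t)) T = t" "merge S T (s, t) \<in> fiber d M S s"
    if t: "t \<in> fiber d T (S \<inter> T) (restrict s (S \<inter> T))" for t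
  proof -
    have eq: "t v = s v" if "v \<in> S" "v \<in> T" for v
    proof -
      have "restrict t (S \<inter> T) v = restrict s (S \<inter> T) v" using t by (simp add: fiber_def)
      then show ?thesis using that by simp
    qed
    have tT: "t \<in> table d T" using t by (simp add: fiber_def)
    show "restrict (merge S T (s, t)) T = t"
      using eq tT by (auto simp: fun_eq_iff merge_def table_def PiE_iff extensional_def)
    have "merge S T (s, t) \<in> table d M"
      using s tT assms(1) by (auto simp: merge_def table_def PiE_iff extensional_def)
    moreover have "restrict (merge S T (s, t)) S = s"
      using s by (auto simp: fun_eq_iff merge_def table_def PiE_iff extensional_def)
    ultimately show "merge S T (s, t) \<in> fiber d M S s" by (simp add: fiber_def)
  qed
  show "\<forall>t\<in>fiber d T (S \<inter> T) (restrict s (S \<inter> T)). restrict (merge S T (s, t)) T = t"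
    using agree(1) by blast
  show "(\<lambda>t. merge S T (s, t)) ` fiber d T (S \<inter> T) (restrict s (S \<inter> T)) \<subseteq> fiber d M S s"
    using agree(2) by blast
  show "(\<lambda>j. restrict j T) ` fiber d M S s \<subseteq> fiber d T (S \<inter> T) (restrict s (S \<inter> T))"
  proof (rule image_subsetI)
    fix j assume j: "j \<in> fiber d M S s"
    then have "restrict s (S \<inter> T) = restrict j (S \<inter> T)"
      by (auto simp: fiber_def)
    then show "restrict j T \<in> fiber d T (S \<inter> T) (restrict s (S \<inter> T))"
      using j assms(1) restrict_in_table[of j d M T]
      by (auto simp: fiber_def Int_absorb1)
  qed
qed

lemma card_fiber:
  assumes "S \<subseteq> M" and "s \<in> table d S"
  shows "card (fiber d M S s) = card (table d (M - S))"
proof -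
  have "fiber d (M - S) (S \<inter> (M - S)) (restrict s (S \<inter> (M - S))) = table d (M - S)"
    by (auto simp: fiber_def restrict_def)
  then show ?thesis
    using bij_betw_same_card[OF bij_betw_restrict_fiber[of S "M - S" M s d]] assms by auto
qed

section \<open>Averages and interactions of functions on a table\<close>

definition average ::
    "('v \<Rightarrow> nat) \<Rightarrow> (('v \<Rightarrow> nat) \<Rightarrow> real) \<Rightarrow> 'v set \<Rightarrow> 'v set \<Rightarrow> ('v \<Rightarrow> nat) \<Rightarrow> real" where
  "average d f L M x = 1 / real (card (table d (M - L))) * sum f (fiber d M L x)"

definition interaction ::
    "('v \<Rightarrow> nat) \<Rightarrow> (('v \<Rightarrow> nat) \<Rightarrow> real) \<Rightarrow> 'v set \<Rightarrow> 'v set \<Rightarrow> ('v \<Rightarrow> nat) \<Rightarrow> real" where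
  "interaction d f L M x =
    (\<Sum>L'\<in>Pow L. (- 1) ^ card (L - L') * average d f L' M (restrict x L'))"

lemma mll_eq_interaction:
  "mll d p L M = interaction d (\<lambda>j. ln (pmf (marginal p M) j)) L M"
  by (simp add: fun_eq_iff mll_def interaction_def nu_def average_def fiber_def Pow_def)

lemma interaction_cong:
  assumes "\<And>j. j \<in> table d M \<Longrightarrow> f j = g j"
  shows "interaction d f L M x = interaction d g L M x"
  unfolding interaction_def average_def
  by (intro sum.cong refl arg_cong2[where f = "(*)"]) (auto simp: fiber_def assms)

lemma interaction_add:
  "interaction d (\<lambda>j. f j + g j) L M x = interaction d f L M x + interaction d g L M x"
  by (simp add: interaction_def average_def sum.distrib distrib_left)

lemma interaction_diff:
  "interaction d (\<lambda>j. f j - g j) L M x = interaction d f L M x - interaction d g L M x"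
  by (simp add: interaction_def average_def sum_subtractf right_diff_distrib)

text \<open>
  Group the points over \<open>x\<close> by their \<open>K\<close>-part: every \<open>k\<close> compatible with \<open>x\<close> extends to the same
  number of points, one for each choice of the coordinates outside \<open>L \<union> K\<close>, and this factor
  cancels against the normalizing constant.
\<close>
lemma average_of_local:
  assumes fin: "finite M" and ne: "table d M \<noteq> {}" and "K \<subseteq> M" "L \<subseteq> M" and x: "x \<in> table d L"
  shows "average d (\<lambda>j. g (restrict j K)) L M x = average d g (L \<inter> K) K (restrict x (L \<inter> K))"
proof -
  let ?x = "restrict x (L \<inter> K)"
  \<comment> \<open>The coordinates that are averaged over in \<open>M\<close> but are invisible to the function.\<close>
  let ?R = "M - (L \<union> K)"
  have finK: "finite K" and finL: "finite L" using assms finite_subset by blast+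
  have count: "card {j \<in> fiber d M L x. restrict j K = k} = card (table d ?R)"
    if k: "k \<in> fiber d K (L \<inter> K) ?x" for k
  proof -
    \<comment> \<open>Prescribing the \<open>L\<close>-part and the \<open>K\<close>-part amounts to prescribing the \<open>L \<union> K\<close>-part.\<close>
    let ?z = "merge L K (x, k)"
    have eq: "k v = x v" if "v \<in> L" "v \<in> K" for v
    proof -
      have "restrict k (L \<inter> K) v = restrict x (L \<inter> K) v" using k by (simp add: fiber_def)
      then show ?thesis using that by simp
    qed
    have kK: "k \<in> table d K" using k by (simp add: fiber_def)
    have z: "?z \<in> table d (L \<union> K)"
      using x kK by (auto simp: merge_def table_def PiE_iff extensional_def)
    have zL: "restrict ?z L = x"
      using x by (auto simp: fun_eq_iff merge_def table_def PiE_iff extensional_def)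
    have zK: "restrict ?z K = k"
      using eq kK by (auto simp: fun_eq_iff merge_def table_def PiE_iff extensional_def)
    have "restrict j (L \<union> K) = ?z \<longleftrightarrow> restrict j L = x \<and> restrict j K = k" for j
    proof
      assume "restrict j (L \<union> K) = ?z"
      then have "restrict (restrict j (L \<union> K)) L = x" "restrict (restrict j (L \<union> K)) K = k"
        using zL zK by auto
      then show "restrict j L = x \<and> restrict j K = k" by (simp add: Int_absorb1)
    next
      assume "restrict j L = x \<and> restrict j K = k"
      moreover have "restrict j (L \<union> K) = merge L K (restrict j L, restrict j K)"
        by (auto simp: fun_eq_iff merge_def)
      ultimately show "restrict j (L \<union> K) = ?z" by simp
    qed
    then have "{j \<in> fiber d M L x. restrict j K = k} = fiber d M (L \<union> K) ?z"
      by (auto simp: fiber_def)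
    then show ?thesis using card_fiber[of "L \<union> K" M ?z d] z assms by auto
  qed
  have img: "(\<lambda>j. restrict j K) ` fiber d M L x \<subseteq> fiber d K (L \<inter> K) ?x"
  proof (rule image_subsetI)
    fix j assume j: "j \<in> fiber d M L x"
    then have "?x = restrict j (L \<inter> K)" by (auto simp: fiber_def)
    then show "restrict j K \<in> fiber d K (L \<inter> K) ?x"
      using j assms restrict_in_table[of j d M K] by (auto simp: fiber_def Int_absorb1)
  qed
  have "(\<Sum>j\<in>fiber d M L x. g (restrict j K))
      = (\<Sum>k\<in>fiber d K (L \<inter> K) ?x. \<Sum>j\<in>{j \<in> fiber d M L x. restrict j K = k}. g (restrict j K))"
    by (rule sum.group[symmetric, OF finite_fiber[OF fin] finite_fiber[OF finK] img])
  also have "\<dots> = (\<Sum>k\<in>fiber d K (L \<inter> K) ?x. real (card (table d ?R)) * g k)"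
    by (intro sum.cong refl) (simp add: count)
  also have "\<dots> = real (card (table d ?R)) * sum g (fiber d K (L \<inter> K) ?x)"
    by (simp add: sum_distrib_left)
  finally have sum_eq: "(\<Sum>j\<in>fiber d M L x. g (restrict j K))
      = real (card (table d ?R)) * sum g (fiber d K (L \<inter> K) ?x)" .
  have "M - L = (K - L \<inter> K) \<union> ?R" using assms by auto
  then have "card (table d (M - L)) = card (table d (K - L \<inter> K)) * card (table d ?R)"
    using card_table_disjoint_Un[of "K - L \<inter> K" ?R d] fin finK by auto
  moreover have "card (table d ?R) > 0"
    using fin ne by (intro card_table_pos table_nonempty_subset[OF ne]) auto
  ultimately show ?thesis by (simp add: average_def sum_eq)
qed

text \<open>
  For subsets of \<open>L \<subseteq> K\<close> the averages over \<open>M\<close> and over \<open>K\<close> agree term by term. This is what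
  makes a parameter of the full table equal to the one of the collapsed table.
\<close>
lemma interaction_of_local_eq:
  assumes "finite M" "table d M \<noteq> {}" "K \<subseteq> M" "L \<subseteq> K" "x \<in> table d L"
  shows "interaction d (\<lambda>j. g (restrict j K)) L M x = interaction d g L K x"
  unfolding interaction_def
proof (intro sum.cong refl arg_cong2[where f = "(*)"])
  fix L' assume "L' \<in> Pow L"
  then have "L' \<inter> K = L'" "L' \<subseteq> M" "restrict x L' \<in> table d L'"
    using assms restrict_in_table by blast+
  then show "average d (\<lambda>j. g (restrict j K)) L' M (restrict x L') = average d g L' K (restrict x L')"
    using average_of_local[of M d K L' "restrict x L'" g] assms by simp
qed

text \<open>
  Take \<open>v \<in> Z - K\<close>. By locality, adding \<open>v\<close> to a set \<open>L\<close> does not change the average but flips the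
  sign with which it enters the alternating sum, so the terms cancel in pairs \<open>L\<close>, \<open>insert v L\<close>.
\<close>
lemma interaction_of_local_eq_0:
  assumes "finite M" "table d M \<noteq> {}" "K \<subseteq> M" "Z \<subseteq> M" "\<not> Z \<subseteq> K" "x \<in> table d Z"
  shows "interaction d (\<lambda>j. g (restrict j K)) Z M x = 0"
proof -
  obtain v where v: "v \<in> Z" "v \<notin> K" using assms by blast
  define Y where "Y = Z - {v}"
  have Z: "Z = insert v Y" "v \<notin> Y" using v by (auto simp: Y_def)
  have finZ: "finite Z" using assms finite_subset by blast
  define a where "a = (\<lambda>L. average d (\<lambda>j. g (restrict j K)) L M (restrict x L))"
  have a: "a L = average d g (L \<inter> K) K (restrict x (L \<inter> K))" if "L \<subseteq> Z" for L
  proof -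
    have "restrict x L \<in> table d L" "L \<subseteq> M" using assms that restrict_in_table by blast+
    then have "a L = average d g (L \<inter> K) K (restrict (restrict x L) (L \<inter> K))"
      unfolding a_def using assms by (intro average_of_local)
    then show ?thesis by (simp add: Int_absorb1)
  qed
  have "interaction d (\<lambda>j. g (restrict j K)) Z M x = (\<Sum>L\<in>Pow Z. (- 1) ^ card (Z - L) * a L)"
    by (simp add: interaction_def a_def)
  also have "\<dots> = (\<Sum>L\<in>Pow Y. (- 1) ^ card (Z - L) * a L)
      + (\<Sum>L\<in>insert v ` Pow Y. (- 1) ^ card (Z - L) * a L)"
    unfolding Z(1) Pow_insert using finZ Z by (intro sum.union_disjoint) auto
  also have "(\<Sum>L\<in>insert v ` Pow Y. (- 1) ^ card (Z - L) * a L)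
      = (\<Sum>L\<in>Pow Y. (- 1) ^ card (Z - insert v L) * a (insert v L))"
    using Z(2) by (intro sum.reindex_cong[of "insert v"]) (auto simp: inj_on_def)
  also have "\<dots> = (\<Sum>L\<in>Pow Y. - ((- 1) ^ card (Z - L) * a L))"
  proof (intro sum.cong refl)
    fix L assume L: "L \<in> Pow Y"
    then have "Z - L = insert v (Z - insert v L)" using Z by auto
    then have "card (Z - L) = Suc (card (Z - insert v L))"
      using finZ by (metis Diff_iff card_insert_disjoint finite_Diff insertI1)
    moreover have "a (insert v L) = a L" using L Z v by (subst (1 2) a) auto
    ultimately show "(- 1) ^ card (Z - insert v L) * a (insert v L) = - ((- 1) ^ card (Z - L) * a L)"
      by simp
  qed
  finally have "interaction d (\<lambda>j. g (restrict j K)) Z M x =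
      (\<Sum>L\<in>Pow Y. (- 1) ^ card (Z - L) * a L) + (\<Sum>L\<in>Pow Y. - ((- 1) ^ card (Z - L) * a L))" .
  then show ?thesis by (rule trans) (simp add: sum_negf)
qed

text \<open>
  By Moebius inversion the interactions with subscripts in \<open>Pow M\<close> sum up to the average with
  nothing left to average over, which is the function itself.
\<close>
lemma sum_interactions:
  assumes fin: "finite M" and x: "x \<in> table d M"
  shows "(\<Sum>Z\<in>Pow M. interaction d f Z M (restrict x Z)) = f x"
proof -
  define h where "h = (\<lambda>L. average d f L M (restrict x L))"
  \<comment> \<open>The sign \<open>(- 1) ^ card Z\<close> brings the inversion into the self-inverse form of
    \<open>inclusion_exclusion_symmetric\<close>.\<close>
  define l where "l = (\<lambda>Z. (- 1) ^ card Z * (\<Sum>L\<in>Pow Z. (- 1) ^ card (Z - L) * h L))"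
  have l: "l S = (\<Sum>L\<in>Pow S. (- 1) ^ card L * h L)" if "finite S" for S
  proof -
    have "(- 1) ^ card S * ((- 1) ^ card (S - L) * h L) = (- 1) ^ card L * h L" if "L \<in> Pow S" for L
    proof -
      have "card S = card L + card (S - L)"
        using that \<open>finite S\<close> card_Diff_subset[of L S] card_mono[of S L] finite_subset[of L S] by auto
      then have "(- 1) ^ card S * (- 1) ^ card (S - L) = ((- 1) ^ card L :: real)"
        by (simp add: power_add mult.assoc flip: power_mult_distrib)
      then show ?thesis by (simp flip: mult.assoc)
    qed
    then show ?thesis unfolding l_def sum_distrib_left by (intro sum.cong refl)
  qed
  have "h M = (\<Sum>Z\<in>Pow M. (- 1) ^ card Z * l Z)"
    by (rule inclusion_exclusion_symmetric[OF l fin])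
  also have "\<dots> = (\<Sum>Z\<in>Pow M. interaction d f Z M (restrict x Z))"
  proof (intro sum.cong refl)
    fix Z assume "Z \<in> Pow M"
    have "(- 1) ^ card Z * l Z = (\<Sum>L\<in>Pow Z. (- 1) ^ card (Z - L) * h L)"
      unfolding l_def by (simp flip: mult.assoc power_mult_distrib)
    also have "\<dots> = interaction d f Z M (restrict x Z)"
      unfolding interaction_def h_def
      by (intro sum.cong refl) (auto simp: Int_absorb1)
    finally show "(- 1) ^ card Z * l Z = interaction d f Z M (restrict x Z)" .
  qed
  finally have "(\<Sum>Z\<in>Pow M. interaction d f Z M (restrict x Z)) = h M" ..
  also have "h M = f x"
  proof -
    have "fiber d M M x = {x}" using x restrict_table_id by (auto simp: fiber_def)
    moreover have "card (table d {}) = 1" by (simp add: table_def)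
    ultimately show ?thesis by (simp add: h_def average_def restrict_table_id[OF x])
  qed
  finally show ?thesis .
qed

section \<open>Marginals and conditional independence\<close>

text \<open>
  Every point of the table over \<open>S\<close> extends to the table over \<open>V\<close>: that table carries a probability
  distribution and is thus nonempty, so any of its points supplies the missing coordinates.
\<close>
lemma set_pmf_marginal:
  assumes "set_pmf p = table d V" "S \<subseteq> V"
  shows "set_pmf (marginal p S) = table d S"
proof -
  have ne: "table d V \<noteq> {}" using assms set_pmf_not_empty by metis
  have "table d S \<subseteq> (\<lambda>j. restrict j S) ` table d V"
  proof
    fix s assume s: "s \<in> table d S"
    obtain j where "j \<in> table d V" using ne by blast
    then have "merge S V (s, j) \<in> table d V"
      using s assms(2) by (auto simp: merge_def table_def PiE_iff extensional_def)
    moreover have "restrict (merge S V (s, j)) S = s"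
      using s by (auto simp: fun_eq_iff merge_def table_def PiE_iff extensional_def)
    ultimately show "s \<in> (\<lambda>j. restrict j S) ` table d V" by (metis imageI)
  qed
  moreover have "(\<lambda>j. restrict j S) ` table d V \<subseteq> table d S"
    using assms restrict_in_table by blast
  ultimately show ?thesis using assms by (simp add: marginal_def)
qed

lemma pmf_marginal_pos:
  assumes "set_pmf p = table d V" "S \<subseteq> V" "x \<in> table d S"
  shows "pmf (marginal p S) x > 0"
  using set_pmf_marginal[OF assms(1,2)] assms(3) by (simp add: pmf_positive)

lemma pmf_marginal_sum:
  assumes "finite V" "set_pmf p = table d V" "S \<subseteq> T" "T \<subseteq> V"
  shows "pmf (marginal p S) s = sum (pmf (marginal p T)) (fiber d T S s)"
proof -
  have "marginal p S = map_pmf (\<lambda>j. restrict j S) (marginal p T)"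
    using assms by (simp add: marginal_def pmf.map_comp o_def Int_absorb1)
  then have "pmf (marginal p S) s
      = measure (marginal p T) ((\<lambda>j. restrict j S) -` {s} \<inter> set_pmf (marginal p T))"
    by (simp add: pmf_map measure_Int_set_pmf)
  also have "(\<lambda>j. restrict j S) -` {s} \<inter> set_pmf (marginal p T) = fiber d T S s"
    using set_pmf_marginal[OF assms(2,4)] by (auto simp: fiber_def)
  also have "measure (marginal p T) \<dots> = sum (pmf (marginal p T)) (fiber d T S s)"
    using assms by (intro measure_measure_pmf_finite finite_fiber) (auto intro: finite_subset)
  finally show ?thesis .
qed

text \<open>
  Summing out the coordinates outside \<open>S\<close> leaves the factor \<open>G\<close> alone and turns \<open>H\<close> into its sum over
  the points of the table over \<open>T\<close> that agree with \<open>s\<close> on \<open>S \<inter> T\<close>.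
\<close>
lemma pmf_marginal_of_product:
  assumes fin: "finite V" and p: "set_pmf p = table d V" and "S \<union> T \<subseteq> V" and "S \<inter> T = C"
    and prod: "\<And>j. j \<in> table d (S \<union> T) \<Longrightarrow>
      pmf (marginal p (S \<union> T)) j = G (restrict j S) * H (restrict j T)"
    and s: "s \<in> table d S"
  shows "pmf (marginal p S) s = G s * sum H (fiber d T C (restrict s C))"
proof -
  have "pmf (marginal p S) s = sum (pmf (marginal p (S \<union> T))) (fiber d (S \<union> T) S s)"
    using assms by (intro pmf_marginal_sum) auto
  also have "\<dots> = (\<Sum>j\<in>fiber d (S \<union> T) S s. G s * H (restrict j T))"
    by (intro sum.cong refl) (auto simp: fiber_def prod)
  also have "\<dots> = (\<Sum>t\<in>fiber d T C (restrict s C). G s * H t)"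
    using sum.reindex_bij_betw[OF bij_betw_restrict_fiber[OF refl s, of T], of "\<lambda>t. G s * H t"]
      \<open>S \<inter> T = C\<close> by simp
  finally show ?thesis by (simp add: sum_distrib_left)
qed

text \<open>
  With the partial sums \<open>g\<close> of \<open>G\<close> and \<open>h\<close> of \<open>H\<close> over the points that share the \<open>C\<close>-part of \<open>x\<close>,
  the marginals at \<open>x\<close> over \<open>A \<union> C\<close>, \<open>B \<union> C\<close> and \<open>C\<close> are \<open>G h\<close>, \<open>H g\<close> and \<open>g h\<close>, so both sides of
  the defining equation are \<open>G H g h\<close>.
\<close>
lemma cond_indep_of_product:
  assumes fin: "finite V" and p: "set_pmf p = table d V" and M: "A \<union> B \<union> C \<subseteq> V"
    and disj: "A \<inter> B = {}"
    and prod: "\<And>j. j \<in> table d (A \<union> B \<union> C) \<Longrightarrow>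
      pmf (marginal p (A \<union> B \<union> C)) j = G (restrict j (A \<union> C)) * H (restrict j (B \<union> C))"
  shows "cond_indep d p A B C"
  unfolding cond_indep_def
proof
  let ?S = "A \<union> C" and ?T = "B \<union> C"
  fix x assume x: "x \<in> table d (A \<union> B \<union> C)"
  let ?c = "restrict x C"
  have ST: "?S \<union> ?T = A \<union> B \<union> C" "?T \<union> ?S = A \<union> B \<union> C" by auto
  have I: "?S \<inter> ?T = C" "?T \<inter> ?S = C" using disj by auto
  have S: "pmf (marginal p ?S) s = G s * sum H (fiber d ?T C (restrict s C))"
    if "s \<in> table d ?S" for s
    by (rule pmf_marginal_of_product[OF fin p _ I(1), unfolded ST(1), OF M prod that])
  have prod': "pmf (marginal p (A \<union> B \<union> C)) j = H (restrict j ?T) * G (restrict j ?S)"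
    if "j \<in> table d (A \<union> B \<union> C)" for j
    using prod[OF that] by (simp only: mult.commute)
  have T: "pmf (marginal p ?T) t = H t * sum G (fiber d ?S C (restrict t C))"
    if "t \<in> table d ?T" for t
    by (rule pmf_marginal_of_product[OF fin p _ I(2), unfolded ST(2), OF M prod' that])
  have "pmf (marginal p C) ?c = sum (pmf (marginal p ?S)) (fiber d ?S C ?c)"
    using M by (intro pmf_marginal_sum[OF fin p]) auto
  also have "\<dots> = (\<Sum>s\<in>fiber d ?S C ?c. G s * sum H (fiber d ?T C ?c))"
    by (intro sum.cong refl) (auto simp: fiber_def S)
  also have "\<dots> = sum G (fiber d ?S C ?c) * sum H (fiber d ?T C ?c)"
    by (simp add: sum_distrib_right)
  finally have C: "pmf (marginal p C) ?c = sum G (fiber d ?S C ?c) * sum H (fiber d ?T C ?c)" .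
  have "restrict x ?S \<in> table d ?S" "restrict x ?T \<in> table d ?T"
    using x by (auto intro: restrict_in_table)
  from S[OF this(1)] T[OF this(2)]
  show "pmf (marginal p (A \<union> B \<union> C)) x * pmf (marginal p C) ?c =
      pmf (marginal p ?S) (restrict x ?S) * pmf (marginal p ?T) (restrict x ?T)"
    by (simp add: prod[OF x] C Int_absorb1 mult_ac)
qed

section \<open>Strict collapsibility\<close>

text \<open>
  The logarithm of the conditional independence equation, to which the linear operator
  \<open>interaction\<close> is applied. Each marginal is kept as a function on the table over \<open>M\<close>, so that
  the locality lemmas apply to it.
\<close>
lemma mll_decomposition_of_cond_indep:
  assumes p: "set_pmf p = table d V" and "M \<subseteq> V" and M: "A \<union> B \<union> C = M"
    and ci: "cond_indep d p A B C"
  shows "mll d p Z M z =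
    interaction d (\<lambda>j. ln (pmf (marginal p (A \<union> C)) (restrict j (A \<union> C)))) Z M z +
    interaction d (\<lambda>j. ln (pmf (marginal p (B \<union> C)) (restrict j (B \<union> C)))) Z M z -
    interaction d (\<lambda>j. ln (pmf (marginal p C) (restrict j C))) Z M z"
  unfolding mll_eq_interaction interaction_add[symmetric] interaction_diff[symmetric]
proof (rule interaction_cong)
  fix j assume j: "j \<in> table d M"
  have sub: "A \<union> C \<subseteq> M" "B \<union> C \<subseteq> M" "C \<subseteq> M" using M by auto
  have pos: "pmf (marginal p S) (restrict j S) > 0" if "S \<subseteq> M" for S
    using pmf_marginal_pos[OF p, of S] restrict_in_table[OF j that] that \<open>M \<subseteq> V\<close> by auto
  have posM: "pmf (marginal p M) j > 0" using pos[of M] restrict_table_id[OF j] by simp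
  have "pmf (marginal p M) j * pmf (marginal p C) (restrict j C) =
      pmf (marginal p (A \<union> C)) (restrict j (A \<union> C)) * pmf (marginal p (B \<union> C)) (restrict j (B \<union> C))"
    using ci j M by (simp add: cond_indep_def)
  from arg_cong[OF this, of ln]
  show "ln (pmf (marginal p M) j) =
      ln (pmf (marginal p (A \<union> C)) (restrict j (A \<union> C))) +
      ln (pmf (marginal p (B \<union> C)) (restrict j (B \<union> C))) -
      ln (pmf (marginal p C) (restrict j C))"
    using posM pos[of C] pos[of "A \<union> C"] pos[of "B \<union> C"] sub by (simp add: ln_mult_pos)
qed

text \<open>
  The subscripts \<open>B'\<close> and \<open>B' \<union> C'\<close> are treated at once: together they are the subsets of
  \<open>B \<union> C\<close> that meet \<open>B\<close>, and meeting \<open>B\<close> is what removes the terms for \<open>A \<union> C\<close> and \<open>C\<close>.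
\<close>
lemma cond_indep_imp_strictly_collapsible:
  assumes fin: "finite V" and p: "set_pmf p = table d V" and "M \<subseteq> V" and M: "A \<union> B \<union> C = M"
    and disj: "A \<inter> B = {}" "A \<inter> C = {}" "B \<inter> C = {}" and "A \<noteq> {}"
    and ci: "cond_indep d p A B C" and L: "L \<subseteq> B \<union> C" "L \<inter> B \<noteq> {}"
  shows "strictly_collapsible d p M (B \<union> C) L"
proof -
  have finM: "finite M" using fin \<open>M \<subseteq> V\<close> finite_subset by blast
  have ne: "table d M \<noteq> {}"
    using set_pmf_marginal[OF p \<open>M \<subseteq> V\<close>] set_pmf_not_empty by metis
  note decompose = mll_decomposition_of_cond_indep[OF p \<open>M \<subseteq> V\<close> M ci]
  note vanish = interaction_of_local_eq_0[OF finM ne]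
  have sub: "A \<union> C \<subseteq> M" "B \<union> C \<subseteq> M" "C \<subseteq> M" using M by auto
  have "mll d p L (B \<union> C) x = mll d p L M x" if x: "x \<in> table d L" for x
  proof -
    have LM: "L \<subseteq> M" and notsub: "\<not> L \<subseteq> A \<union> C" "\<not> L \<subseteq> C" using L disj M by blast+
    show ?thesis
      unfolding decompose
        vanish[of "A \<union> C" L x "\<lambda>j. ln (pmf (marginal p (A \<union> C)) j)", OF sub(1) LM notsub(1) x]
        vanish[of C L x "\<lambda>j. ln (pmf (marginal p C) j)", OF sub(3) LM notsub(2) x]
        interaction_of_local_eq[OF finM ne sub(2) L(1) x, of "\<lambda>j. ln (pmf (marginal p (B \<union> C)) j)"]
      by (simp add: mll_eq_interaction)
  qed
  moreover have "mll d p Z M x = 0"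
    if Z: "Z \<subseteq> M" "L \<subset> Z" "\<not> Z \<subseteq> B \<union> C" and x: "x \<in> table d Z" for Z x
  proof -
    have notsub: "\<not> Z \<subseteq> A \<union> C" "\<not> Z \<subseteq> C" using Z L disj by blast+
    show ?thesis
      unfolding decompose
        vanish[of "A \<union> C" Z x "\<lambda>j. ln (pmf (marginal p (A \<union> C)) j)", OF sub(1) Z(1) notsub(1) x]
        vanish[of "B \<union> C" Z x "\<lambda>j. ln (pmf (marginal p (B \<union> C)) j)", OF sub(2) Z(1,3) x]
        vanish[of C Z x "\<lambda>j. ln (pmf (marginal p C) j)", OF sub(3) Z(1) notsub(2) x]
      by simp
  qed
  ultimately show ?thesis
    using L M disj \<open>A \<noteq> {}\<close> by (auto simp: strictly_collapsible_def)
qed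

text \<open>
  In the expansion of \<open>ln p\<^sub>M\<close> into interactions, the surviving subscripts miss \<open>A\<close> or \<open>B\<close>, so they
  lie in \<open>B \<union> C\<close> or in \<open>A \<union> C\<close>. Exponentials of the two partial sums are the factors of \<open>p\<^sub>M\<close>.
\<close>
lemma vanishing_mll_imp_cond_indep:
  assumes fin: "finite V" and p: "set_pmf p = table d V" and "M \<subseteq> V" and M: "A \<union> B \<union> C = M"
    and disj: "A \<inter> B = {}"
    and zero: "\<And>Z z. Z \<subseteq> M \<Longrightarrow> Z \<inter> A \<noteq> {} \<Longrightarrow> Z \<inter> B \<noteq> {} \<Longrightarrow> z \<in> table d Z \<Longrightarrow> mll d p Z M z = 0"
  shows "cond_indep d p A B C"
proof -
  have finM: "finite M" using fin \<open>M \<subseteq> V\<close> finite_subset by blast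
  \<comment> \<open>Subscripts contained in \<open>C\<close> could go to either factor; they are counted in \<open>g\<close> only.\<close>
  define g where "g = (\<lambda>y. \<Sum>Z\<in>{Z \<in> Pow M. Z \<inter> B = {}}. mll d p Z M (restrict y Z))"
  define h where "h = (\<lambda>y. \<Sum>Z\<in>{Z \<in> Pow M. Z \<inter> A = {} \<and> Z \<inter> B \<noteq> {}}. mll d p Z M (restrict y Z))"
  have "pmf (marginal p M) j = exp (g (restrict j (A \<union> C))) * exp (h (restrict j (B \<union> C)))"
    if j: "j \<in> table d M" for j
  proof -
    have "ln (pmf (marginal p M) j) = (\<Sum>Z\<in>Pow M. mll d p Z M (restrict j Z))"
      unfolding mll_eq_interaction by (rule sum_interactions[OF finM j, symmetric])
    also have "\<dots> = (\<Sum>Z\<in>{Z \<in> Pow M. Z \<inter> B = {}} \<union> {Z \<in> Pow M. Z \<inter> A = {} \<and> Z \<inter> B \<noteq> {}}.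
        mll d p Z M (restrict j Z))"
    proof (intro sum.mono_neutral_right ballI)
      fix Z assume "Z \<in> Pow M - ({Z \<in> Pow M. Z \<inter> B = {}} \<union> {Z \<in> Pow M. Z \<inter> A = {} \<and> Z \<inter> B \<noteq> {}})"
      then have "Z \<subseteq> M" "Z \<inter> A \<noteq> {}" "Z \<inter> B \<noteq> {}" by blast+
      then show "mll d p Z M (restrict j Z) = 0" by (intro zero restrict_in_table[OF j])
    qed (use finM in auto)
    also have "\<dots> = g j + h j"
      unfolding g_def h_def using finM by (intro sum.union_disjoint) auto
    also have "g j = g (restrict j (A \<union> C))"
      unfolding g_def
    proof (intro sum.cong refl)
      fix Z assume "Z \<in> {Z \<in> Pow M. Z \<inter> B = {}}"
      then have "Z \<subseteq> A \<union> C" using M by auto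
      then show "mll d p Z M (restrict j Z) = mll d p Z M (restrict (restrict j (A \<union> C)) Z)"
        by (simp only: restrict_restrict_subset)
    qed
    also have "h j = h (restrict j (B \<union> C))"
      unfolding h_def
    proof (intro sum.cong refl)
      fix Z assume "Z \<in> {Z \<in> Pow M. Z \<inter> A = {} \<and> Z \<inter> B \<noteq> {}}"
      then have "Z \<subseteq> B \<union> C" using M by auto
      then show "mll d p Z M (restrict j Z) = mll d p Z M (restrict (restrict j (B \<union> C)) Z)"
        by (simp only: restrict_restrict_subset)
    qed
    finally have "exp (ln (pmf (marginal p M) j))
        = exp (g (restrict j (A \<union> C))) * exp (h (restrict j (B \<union> C)))"
      by (simp only: exp_add)
    then show ?thesis using pmf_marginal_pos[OF p \<open>M \<subseteq> V\<close> j] by simp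
  qed
  then show ?thesis
    unfolding M[symmetric]
    by (rule cond_indep_of_product[OF fin p \<open>M \<subseteq> V\<close>[folded M] disj,
          where G = "\<lambda>y. exp (g y)" and H = "\<lambda>y. exp (h y)"])
qed

lemma strictly_collapsible_iff_cond_indep:
  assumes fin: "finite V" and p: "set_pmf p = table d V" and "M \<subseteq> V" and M: "A \<union> B \<union> C = M"
    and disj: "A \<inter> B = {}" "A \<inter> C = {}" "B \<inter> C = {}" and "A \<noteq> {}"
  shows "(\<forall>B'. B' \<noteq> {} \<and> B' \<subseteq> B \<longrightarrow>
      strictly_collapsible d p M (B \<union> C) B' \<and>
      (\<forall>C'. C' \<noteq> {} \<and> C' \<subseteq> C \<longrightarrow> strictly_collapsible d p M (B \<union> C) (B' \<union> C')))
    \<longleftrightarrow> cond_indep d p A B C" (is "?coll \<longleftrightarrow> _")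
proof
  assume coll: ?coll
  show "cond_indep d p A B C"
  proof (rule vanishing_mll_imp_cond_indep[OF fin p \<open>M \<subseteq> V\<close> M disj(1)])
    fix Z z assume Z: "Z \<subseteq> M" "Z \<inter> A \<noteq> {}" "Z \<inter> B \<noteq> {}" "z \<in> table d Z"
    have "Z \<inter> B \<noteq> {} \<and> Z \<inter> B \<subseteq> B" using Z(3) by simp
    then have "strictly_collapsible d p M (B \<union> C) (Z \<inter> B)"
      by (rule coll[THEN spec, THEN mp, THEN conjunct1])
    then have zero: "\<forall>Z'. Z' \<subseteq> M \<and> Z \<inter> B \<subset> Z' \<and> \<not> Z' \<subseteq> B \<union> C \<longrightarrow>
        (\<forall>x\<in>table d Z'. mll d p Z' M x = 0)"
      unfolding strictly_collapsible_def by (elim conjE)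
    have "Z \<inter> B \<subset> Z" "\<not> Z \<subseteq> B \<union> C" using Z(2) disj by blast+
    then show "mll d p Z M z = 0" using zero[THEN spec, of Z] Z(1,4) by simp
  qed
next
  assume ci: "cond_indep d p A B C"
  note coll = cond_indep_imp_strictly_collapsible[OF fin p \<open>M \<subseteq> V\<close> M disj \<open>A \<noteq> {}\<close> ci]
  show ?coll
  proof (intro allI impI conjI)
    fix B' assume B': "B' \<noteq> {} \<and> B' \<subseteq> B"
    then have "B' \<subseteq> B \<union> C" "B' \<inter> B \<noteq> {}" by blast+
    then show "strictly_collapsible d p M (B \<union> C) B'" by (rule coll)
    fix C' assume "C' \<noteq> {} \<and> C' \<subseteq> C"
    then have "B' \<union> C' \<subseteq> B \<union> C" "(B' \<union> C') \<inter> B \<noteq> {}" using B' by blast+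
    then show "strictly_collapsible d p M (B \<union> C) (B' \<union> C')" by (rule coll)
  qed
qed

lemma cond_indep_commute: "cond_indep d p A B C \<longleftrightarrow> cond_indep d p B A C"
  unfolding cond_indep_def Un_commute[of B A] by (simp only: mult.commute)

theorem theorem4p1:
  fixes V M A B C :: "'v set" and d :: "'v \<Rightarrow> nat" and p :: "('v \<Rightarrow> nat) pmf"
  assumes "finite V"
    and "set_pmf p = table d V"
    and "M \<subseteq> V"
    and "A \<union> B \<union> C = M"
    and "A \<inter> B = {}" and "A \<inter> C = {}" and "B \<inter> C = {}"
    and "A \<noteq> {}" and "B \<noteq> {}"
  shows
    "((\<forall>B'. B' \<noteq> {} \<and> B' \<subseteq> B \<longrightarrow>
         strictly_collapsible d p M (B \<union> C) B' \<and>
         (\<forall>C'. C' \<noteq> {} \<and> C' \<subseteq> C \<longrightarrow> strictly_collapsible d p M (B \<union> C) (B' \<union> C')))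
      \<longleftrightarrow> cond_indep d p A B C) \<and>
     ((\<forall>A'. A' \<noteq> {} \<and> A' \<subseteq> A \<longrightarrow>
         strictly_collapsible d p M (A \<union> C) A' \<and>
         (\<forall>C'. C' \<noteq> {} \<and> C' \<subseteq> C \<longrightarrow> strictly_collapsible d p M (A \<union> C) (A' \<union> C')))
      \<longleftrightarrow> cond_indep d p A B C)"
proof
  show "(\<forall>B'. B' \<noteq> {} \<and> B' \<subseteq> B \<longrightarrow>
         strictly_collapsible d p M (B \<union> C) B' \<and>
         (\<forall>C'. C' \<noteq> {} \<and> C' \<subseteq> C \<longrightarrow> strictly_collapsible d p M (B \<union> C) (B' \<union> C')))
      \<longleftrightarrow> cond_indep d p A B C"
    using assms by (intro strictly_collapsible_iff_cond_indep)
  have "B \<union> A \<union> C = M" "B \<inter> A = {}" using assms by auto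
  then show "(\<forall>A'. A' \<noteq> {} \<and> A' \<subseteq> A \<longrightarrow>
         strictly_collapsible d p M (A \<union> C) A' \<and>
         (\<forall>C'. C' \<noteq> {} \<and> C' \<subseteq> C \<longrightarrow> strictly_collapsible d p M (A \<union> C) (A' \<union> C')))
      \<longleftrightarrow> cond_indep d p A B C"
    using assms unfolding cond_indep_commute[of d p A B C]
    by (intro strictly_collapsible_iff_cond_indep)
qed

end
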